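(* Let $\mathscr{M}A=M(A)\rtimes A$ and $\mathscr{N}B=N(B)\rtimes B$ be two finitely generated halo products, with $A,B$ infinite, with $\mathscr{M},\mathscr{N}$ charming and with $M(A),N(B)$ locally finite. If there exists an aptolic coarse embedding $\mathscr{M}A\to\mathscr{N}B$, then $\Lambda_{\mathscr{M}}\prec\Lambda_{\mathscr{N}}$.
   Context: Halo products: let $H$ be a group. A halo of groups $\mathscr{L}$ over $H$ is the data, for every subset $S \subset H$, of a group $L(S)$ such that: (i) if $R \subset S \subset H$ then $L(R) \leq L(S)$; (ii) $L(\emptyset)=\{1\}$ and $L(H)=\langle L(S) : S \subset H \text{ finite}\rangle$; (iii) $L(R)\cap L(S)=L(R\cap S)$ for all $R,S\subset H$. Given a morphism $\alpha : H \to \mathrm{Aut}(L(H))$ with $\alpha(h)(L(S))=L(hS)$ for all $h\in H$, $S\subset H$, the halo product $\mathscr{L}H$ is the semidirect product $L(H)\rtimes_\alpha H$; its elements are written $(c,p)$ with $c\in L(H)$, $p\in H$. For the halos $\mathscr{M}$ over $A$ and $\mathscr{N}$ over $B$ the groups are denoted $M(S)$, $N(S)$. Finitely generated groups are endowed with finite generating sets and identified with the corresponding Cayley graphs and word metrics. Charming: a halo of groups $\mathscr{L}$ over a connected graph $X$ (vertex set) is charming if (a) there is $D\ge 0$ such that $L(S)\subset\left\langle\bigcup_{s\in S}L(B(s,D))\right\rangle$ for every connected $S\subset X$; (b) for $S$ connected, the size of $L(S)$ only depends on the size of $S$. Lamp growth sequence of a charming $\mathscr{L}$ over an infinite connected locally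 finite graph $X$ with $L(X)$ locally finite: $\Lambda_{\mathscr{L}}(n)=|L(S)|$ where $S\subset X$ is any connected subset with $|S|=n$. Coarse embedding: a map $f:X\to Y$ between metric spaces for which there are functions $\sigma_-,\sigma_+:[0,\infty)\to[0,\infty)$ tending to $+\infty$ with $\sigma_-(d(x,y))\le d(f(x),f(y))\le\sigma_+(d(x,y))$ for all $x,y$. A coarse embedding $\rho:\mathscr{M}A\to\mathscr{N}B$ is aptolic if there exist an injective map $\alpha:M(A)\to N(B)$ and a coarse embedding $\beta:A\to B$ such that $\rho(c,p)=(\alpha(c),\beta(p))$ for all $(c,p)\in\mathscr{M}A$. Domination: for $\varphi,\psi:\mathbb{N}\to\mathbb{N}$, $\varphi\prec\psi$ means that there is an integer $C\ge 0$ with $\varphi(n)\le\psi(Cn)$ for every $n\ge 1$.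
   Formalization: The formal theorem also assumes that M(S) and N(S) are finite for every finite connected S, so that the lamp growth sequences take values in the natural numbers; this does not follow from M(A), N(B) being locally finite. *)

theory Defs
  imports Complex_Main "HOL-Algebra.Generated_Groups" "HOL-Algebra.Bij" "HOL-Library.Equipollence"
begin

section \<open>Graphs, Cayley graphs and word metrics\<close>

text \<open>A graph is given by a vertex set and a symmetric relation \<open>E\<close> (its edges).
  The value of \<open>graph_dist\<close> is only meaningful for vertices joined by a path.\<close>

definition graph_dist :: "('a \<times> 'a) set \<Rightarrow> 'a \<Rightarrow> 'a \<Rightarrow> nat" where
  "graph_dist E x y = (LEAST n. (x, y) \<in> E ^^ n)"

definition graph_ball :: "'a set \<Rightarrow> ('a \<times> 'a) set \<Rightarrow> 'a \<Rightarrow> nat \<Rightarrow> 'a set" where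
  "graph_ball X E s D = {y \<in> X. graph_dist E s y \<le> D}"

text \<open>A set of vertices is connected if the subgraph it induces is connected; the empty set counts
  as connected, so that the value at 0 of a lamp growth sequence is determined (it is 1).\<close>

definition connected_subset :: "'a set \<Rightarrow> ('a \<times> 'a) set \<Rightarrow> 'a set \<Rightarrow> bool" where
  "connected_subset X E S \<longleftrightarrow>
     S \<subseteq> X \<and> (\<forall>x\<in>S. \<forall>y\<in>S. (x, y) \<in> (E \<inter> S \<times> S)\<^sup>*)"

definition finite_generating_set :: "('a, 'm) monoid_scheme \<Rightarrow> 'a set \<Rightarrow> bool" where
  "finite_generating_set G T \<longleftrightarrow> finite T \<and> T \<subseteq> carrier G \<and> generate G T = carrier G"

definition cayley_edges :: "('a, 'm) monoid_scheme \<Rightarrow> 'a set \<Rightarrow> ('a \<times> 'a) set" where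
  "cayley_edges G T =
     {(x, y). x \<in> carrier G \<and> y \<in> carrier G \<and> (\<exists>t\<in>T. y = x \<otimes>\<^bsub>G\<^esub> t \<or> x = y \<otimes>\<^bsub>G\<^esub> t)}"

definition word_dist :: "('a, 'm) monoid_scheme \<Rightarrow> 'a set \<Rightarrow> 'a \<Rightarrow> 'a \<Rightarrow> real" where
  "word_dist G T x y = real (graph_dist (cayley_edges G T) x y)"

definition locally_finite_group :: "('a, 'm) monoid_scheme \<Rightarrow> bool" where
  "locally_finite_group G \<longleftrightarrow>
     group G \<and> (\<forall>F. F \<subseteq> carrier G \<longrightarrow> finite F \<longrightarrow> finite (generate G F))"


section \<open>Halos and halo products\<close>

text \<open>The group \<open>G\<close> is the group attached to the whole set \<open>X\<close>; the other groups of the halo are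
  its subgroups \<open>L S\<close>. Values of \<open>L\<close> at sets that are not contained in \<open>X\<close> play no role.\<close>

definition halo :: "'a set \<Rightarrow> ('g, 'm) monoid_scheme \<Rightarrow> ('a set \<Rightarrow> 'g set) \<Rightarrow> bool" where
  "halo X G L \<longleftrightarrow>
     group G \<and> L X = carrier G \<and>
     (\<forall>S. S \<subseteq> X \<longrightarrow> subgroup (L S) G) \<and>
     (\<forall>R S. R \<subseteq> S \<longrightarrow> S \<subseteq> X \<longrightarrow> L R \<subseteq> L S) \<and>
     L {} = {\<one>\<^bsub>G\<^esub>} \<and>
     L X = generate G (\<Union>{L S | S. S \<subseteq> X \<and> finite S}) \<and>
     (\<forall>R S. R \<subseteq> X \<longrightarrow> S \<subseteq> X \<longrightarrow> L R \<inter> L S = L (R \<inter> S))"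

definition halo_action ::
  "('a, 'm) monoid_scheme \<Rightarrow> ('g, 'n) monoid_scheme \<Rightarrow> ('a set \<Rightarrow> 'g set) \<Rightarrow> ('a \<Rightarrow> 'g \<Rightarrow> 'g) \<Rightarrow> bool" where
  "halo_action H G L \<phi> \<longleftrightarrow>
     \<phi> \<in> hom H (AutoGroup G) \<and>
     (\<forall>h\<in>carrier H. \<forall>S. S \<subseteq> carrier H \<longrightarrow> \<phi> h ` L S = L (h <#\<^bsub>H\<^esub> S))"

definition semidirect_product ::
  "('g, 'n) monoid_scheme \<Rightarrow> ('a, 'm) monoid_scheme \<Rightarrow> ('a \<Rightarrow> 'g \<Rightarrow> 'g) \<Rightarrow> ('g \<times> 'a) monoid" where
  "semidirect_product G H \<phi> =
     \<lparr>carrier = carrier G \<times> carrier H,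
      mult = (\<lambda>(c, p) (d, q). (c \<otimes>\<^bsub>G\<^esub> \<phi> p d, p \<otimes>\<^bsub>H\<^esub> q)),
      one = (\<one>\<^bsub>G\<^esub>, \<one>\<^bsub>H\<^esub>)\<rparr>"

text \<open>The data of a halo product: its underlying group is \<open>semidirect_product G H \<phi>\<close>.\<close>

definition halo_product ::
  "('a, 'm) monoid_scheme \<Rightarrow> ('g, 'n) monoid_scheme \<Rightarrow> ('a set \<Rightarrow> 'g set) \<Rightarrow> ('a \<Rightarrow> 'g \<Rightarrow> 'g) \<Rightarrow> bool" where
  "halo_product H G L \<phi> \<longleftrightarrow> group H \<and> halo (carrier H) G L \<and> halo_action H G L \<phi>"


section \<open>Charming halos and lamp growth\<close>

definition charming ::
  "'a set \<Rightarrow> ('a \<times> 'a) set \<Rightarrow> ('g, 'm) monoid_scheme \<Rightarrow> ('a set \<Rightarrow> 'g set) \<Rightarrow> bool" where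
  "charming X E G L \<longleftrightarrow>
     (\<exists>D. \<forall>S. connected_subset X E S \<longrightarrow> L S \<subseteq> generate G (\<Union>s\<in>S. L (graph_ball X E s D))) \<and>
     (\<forall>R S. connected_subset X E R \<longrightarrow> connected_subset X E S \<longrightarrow> R \<approx> S \<longrightarrow> L R \<approx> L S)"

text \<open>\<open>\<Lambda>\<close> is the lamp growth sequence of \<open>L\<close>: its value at \<open>n\<close> is the order of the group attached
  to any connected set with \<open>n\<close> elements. This sequence has values in the natural numbers, i.e. its
  definition presupposes that these groups are finite. That is not automatic: take for \<open>G\<close> the
  class 2 nilpotent group of exponent 3 freely generated by \<open>x\<^sub>i\<close> with \<open>i \<in> \<int>\<close>, shifted by \<open>\<int>\<close>,
  and let \<open>L S\<close> be generated by the elements \<open>x\<^sub>i\<close> and the commutators \<open>[x\<^sub>i, x\<^sub>j]\<close> with \<open>i \<in> S\<close> and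
  \<open>i < j\<close>. This halo is charming, \<open>G\<close> is locally finite and the halo product is finitely generated,
  but \<open>L S\<close> is infinite for nonempty \<open>S\<close>.\<close>

definition lamp_growth_sequence ::
  "'a set \<Rightarrow> ('a \<times> 'a) set \<Rightarrow> ('a set \<Rightarrow> 'g set) \<Rightarrow> (nat \<Rightarrow> nat) \<Rightarrow> bool" where
  "lamp_growth_sequence X E L \<Lambda> \<longleftrightarrow>
     (\<forall>n S. connected_subset X E S \<longrightarrow> finite S \<longrightarrow> card S = n \<longrightarrow> finite (L S) \<and> card (L S) = \<Lambda> n)"

text \<open>Finiteness is the only presupposition.\<close>

lemma charming_lamp_growth_sequence_exists:
  assumes "charming X E G L"
    and fin: "\<And>S. connected_subset X E S \<Longrightarrow> finite S \<Longrightarrow> finite (L S)"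
  shows "\<exists>\<Lambda>. lamp_growth_sequence X E L \<Lambda>"
proof -
  define P where "P n S \<longleftrightarrow> connected_subset X E S \<and> finite S \<and> card S = n" for n S
  define \<Lambda> where "\<Lambda> n = card (L (SOME S. P n S))" for n
  have "card (L S) = \<Lambda> n" if "P n S" for n S
  proof -
    have R: "P n (SOME S. P n S)"
      using that by (rule someI)
    have "S \<approx> (SOME S. P n S)"
      using that R unfolding P_def eqpoll_def by (metis finite_same_card_bij)
    then have "L S \<approx> L (SOME S. P n S)"
      using assms(1) that R unfolding charming_def P_def by blast
    then show ?thesis
      unfolding \<Lambda>_def eqpoll_def by (blast intro: bij_betw_same_card)
  qed
  with fin show ?thesis
    unfolding lamp_growth_sequence_def P_def by blast
qed


section \<open>Coarse embeddings and domination\<close>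

definition coarse_embedding ::
  "'a set \<Rightarrow> ('a \<Rightarrow> 'a \<Rightarrow> real) \<Rightarrow> 'b set \<Rightarrow> ('b \<Rightarrow> 'b \<Rightarrow> real) \<Rightarrow> ('a \<Rightarrow> 'b) \<Rightarrow> bool" where
  "coarse_embedding X dX Y dY f \<longleftrightarrow>
     f \<in> X \<rightarrow> Y \<and>
     (\<exists>\<sigma>1 \<sigma>2 :: real \<Rightarrow> real.
        (\<forall>t\<ge>0. \<sigma>1 t \<ge> 0 \<and> \<sigma>2 t \<ge> 0) \<and>
        filterlim \<sigma>1 at_top at_top \<and> filterlim \<sigma>2 at_top at_top \<and>
        (\<forall>x\<in>X. \<forall>y\<in>X. \<sigma>1 (dX x y) \<le> dY (f x) (f y) \<and> dY (f x) (f y) \<le> \<sigma>2 (dX x y)))"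

text \<open>A coarse embedding between the halo products \<open>semidirect_product GM A \<phi>\<close> and
  \<open>semidirect_product GN B \<psi>\<close> that is aptolic; \<open>TA\<close>, \<open>TB\<close>, \<open>TMA\<close>, \<open>TNB\<close> are the finite
  generating sets of \<open>A\<close>, \<open>B\<close> and the two products that define the word metrics.\<close>

definition aptolic_coarse_embedding where
  "aptolic_coarse_embedding A TA GM \<phi> TMA B TB GN \<psi> TNB \<rho> \<longleftrightarrow>
     coarse_embedding
       (carrier (semidirect_product GM A \<phi>)) (word_dist (semidirect_product GM A \<phi>) TMA)
       (carrier (semidirect_product GN B \<psi>)) (word_dist (semidirect_product GN B \<psi>) TNB) \<rho> \<and>
     (\<exists>\<alpha> \<beta>. \<alpha> \<in> carrier GM \<rightarrow> carrier GN \<and> inj_on \<alpha> (carrier GM) \<and>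
        coarse_embedding (carrier A) (word_dist A TA) (carrier B) (word_dist B TB) \<beta> \<and>
        (\<forall>c\<in>carrier GM. \<forall>p\<in>carrier A. \<rho> (c, p) = (\<alpha> c, \<beta> p)))"

definition dominated :: "(nat \<Rightarrow> nat) \<Rightarrow> (nat \<Rightarrow> nat) \<Rightarrow> bool" where
  "dominated \<phi> \<psi> \<longleftrightarrow> (\<exists>C::nat. \<forall>n\<ge>1. \<phi> n \<le> \<psi> (C * n))"

end

theory Submission
  imports Defs
begin

text \<open>Write \<open>\<rho> (c, p) = (\<alpha> c, \<beta> p)\<close>, and let \<open>S\<close> be a connected set of \<open>n\<close> elements of \<open>A\<close>. The aim
  is to trap the injective image \<open>\<alpha> (M S)\<close> in a coset of \<open>N W\<close>, where \<open>W\<close> is a connected set whose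
  size is at most a constant times \<open>n\<close>.

  Because \<open>M\<close> is charming, an element of \<open>M S\<close> is a product of factors \<open>d\<close>, each in some
  \<open>M (B(s, D))\<close> with \<open>s \<in> S\<close>. Multiplying \<open>c\<close> by such a \<open>d\<close> can be done by an arrow that stands at
  \<open>s\<close>: the distance between \<open>(c, s)\<close> and \<open>(c d, s)\<close> is one of finitely many values, because \<open>A\<close> acts
  transitively on the balls and \<open>M (B(1, D))\<close> is finite (lemma \<open>finite_local_displacements\<close>). Hence
  \<open>(\<alpha> c, \<beta> s)\<close> and \<open>(\<alpha> (c d), \<beta> s)\<close> lie at bounded distance. Conversely, a bounded displacement of
  the lamps by an arrow at \<open>q \<in> B\<close> only changes lamps near \<open>q\<close>: there is a finite \<open>F\<close>, independent of
  \<open>q\<close>, such that the change lies in \<open>N (q F)\<close> (lemma \<open>bounded_displacements_are_local\<close>). So every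
  factor changes the image under \<open>\<alpha>\<close> by an element of \<open>N (\<beta> s F)\<close>, and \<open>\<alpha> c\<close> belongs to
  \<open>\<alpha> 1 \<cdot> N W\<close> as soon as \<open>W\<close> contains all \<open>\<beta> s F\<close> (lemma \<open>aptolic_lamp_image\<close>).

  Since \<open>\<beta>\<close> is also a coarse embedding, it moves neighbours to bounded distance, so the balls of a
  suitable radius \<open>k\<close> around the points of \<open>\<beta> S\<close> have a connected union that contains all
  \<open>\<beta> s F\<close>. The union has at most \<open>C n\<close> elements, where \<open>C\<close> is the size of one ball, and in the
  infinite connected graph of \<open>B\<close> it extends to a connected \<open>W\<close> with exactly \<open>C n\<close> elements. Therefore
  \<open>\<Lambda>\<^sub>M n = |M S| \<le> |N W| = \<Lambda>\<^sub>N (C n)\<close>.\<close>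

section \<open>Connected sets and balls in a connected graph\<close>

locale connected_graph =
  fixes X :: "'a set" and E :: "('a \<times> 'a) set"
  assumes edges: "E \<subseteq> X \<times> X"
    and sym_edges: "sym E"
    and connected: "connected_subset X E X"
begin

lemma reachable:
  assumes "x \<in> X" "y \<in> X"
  shows "(x, y) \<in> E\<^sup>*"
proof -
  have "E \<inter> X \<times> X = E" using edges by blast
  then show ?thesis using assms connected unfolding connected_subset_def by auto
qed

lemma graph_dist_le_iff:
  assumes "x \<in> X" "y \<in> X"
  shows "graph_dist E x y \<le> k \<longleftrightarrow> (\<exists>n\<le>k. (x, y) \<in> E ^^ n)"
proof
  assume k: "graph_dist E x y \<le> k"
  obtain n where "(x, y) \<in> E ^^ n" using reachable[OF assms] rtrancl_imp_relpow by blast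
  then have "(x, y) \<in> E ^^ graph_dist E x y" unfolding graph_dist_def by (rule LeastI)
  then show "\<exists>n\<le>k. (x, y) \<in> E ^^ n" using k by blast
next
  assume "\<exists>n\<le>k. (x, y) \<in> E ^^ n"
  then obtain n where "n \<le> k" "(x, y) \<in> E ^^ n" by blast
  then show "graph_dist E x y \<le> k" unfolding graph_dist_def by (meson Least_le le_trans)
qed

lemma center_in_ball: "x \<in> X \<Longrightarrow> x \<in> graph_ball X E x k"
  unfolding graph_ball_def graph_dist_def by (simp add: Least_eq_0)

text \<open>Edges are symmetric, so it suffices to reach every point from a single one.\<close>

lemma connected_subset_if_star:
  assumes "S \<subseteq> X" and star: "\<And>y. y \<in> S \<Longrightarrow> (x, y) \<in> (E \<inter> S \<times> S)\<^sup>*"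
  shows "connected_subset X E S"
  unfolding connected_subset_def
proof (intro conjI ballI)
  fix y z assume "y \<in> S" "z \<in> S"
  have "sym (E \<inter> S \<times> S)" using sym_edges by (auto simp: sym_def)
  then have "(y, x) \<in> (E \<inter> S \<times> S)\<^sup>*" using star[OF \<open>y \<in> S\<close>] by (meson sym_rtrancl symD)
  then show "(y, z) \<in> (E \<inter> S \<times> S)\<^sup>*" using star[OF \<open>z \<in> S\<close>] by simp
qed (fact assms)

lemma connected_ball:
  assumes x: "x \<in> X"
  shows "connected_subset X E (graph_ball X E x k)"
proof (rule connected_subset_if_star[where x = x])
  let ?S = "graph_ball X E x k"
  show "?S \<subseteq> X" by (auto simp: graph_ball_def)
  have walk: "n \<le> k \<Longrightarrow> (x, y) \<in> E ^^ n \<Longrightarrow> (x, y) \<in> (E \<inter> ?S \<times> ?S)\<^sup>*" for n y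
  proof (induction n arbitrary: y)
    case (Suc n)
    then obtain z where z: "(x, z) \<in> E ^^ n" "(z, y) \<in> E" by auto
    have zy: "z \<in> X" "y \<in> X" using z(2) edges by auto
    have "z \<in> ?S" "y \<in> ?S"
      unfolding graph_ball_def using zy Suc.prems z(1) graph_dist_le_iff[OF x]
      by (auto simp del: relpow.simps intro: exI[of _ n] exI[of _ "Suc n"])
    then show ?case using Suc.IH[of z] Suc.prems(1) z by (auto intro: rtrancl_into_rtrancl)
  qed auto
  show "(x, y) \<in> (E \<inter> ?S \<times> ?S)\<^sup>*" if "y \<in> ?S" for y
    using that walk graph_dist_le_iff[OF x] unfolding graph_ball_def by blast
qed

lemma finite_ball:
  assumes loc: "\<And>y. finite (E `` {y})" and x: "x \<in> X"
  shows "finite (graph_ball X E x k)"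
proof -
  have "finite ((E ^^ n) `` {x})" for n
  proof (induction n)
    case (Suc n)
    have "(E ^^ Suc n) `` {x} = (\<Union>y\<in>(E ^^ n) `` {x}. E `` {y})" by auto
    then show ?case using Suc loc by (simp del: relpow.simps)
  qed simp
  moreover have "graph_ball X E x k \<subseteq> (\<Union>n\<le>k. (E ^^ n) `` {x})"
    using graph_dist_le_iff[OF x] unfolding graph_ball_def by blast
  ultimately show ?thesis by (meson finite_UN_I finite_atMost finite_subset)
qed

text \<open>A finite set is not the whole of an infinite connected graph, so some edge leaves it; adding the
  other end of that edge enlarges a connected set by one point and keeps it connected.\<close>

lemma connected_superset:
  assumes "infinite X" "connected_subset X E S" "finite S" "S \<noteq> {}" "card S \<le> n"
  shows "\<exists>S'. S \<subseteq> S' \<and> connected_subset X E S' \<and> finite S' \<and> card S' = n"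
  using \<open>card S \<le> n\<close>
proof (induction rule: dec_induct)
  case base
  then show ?case using assms by blast
next
  case (step n)
  then obtain U where U: "S \<subseteq> U" "connected_subset X E U" "finite U" "card U = n" by blast
  obtain x where x: "x \<in> U" using U(1) assms(4) by blast
  have UX: "U \<subseteq> X" using U(2) by (simp add: connected_subset_def)
  obtain z where z: "z \<in> X" "z \<notin> U" using assms(1) U(3) by (meson finite_subset subsetI)
  have "\<exists>u v. u \<in> U \<and> v \<notin> U \<and> (u, v) \<in> E"
  proof (rule ccontr)
    assume H: "\<not> ?thesis"
    have "(x, z) \<in> E\<^sup>*" using reachable x z UX by blast
    then have "z \<in> U" using x H by (induction rule: rtrancl_induct) auto
    then show False using z by simp
  qed
  then obtain u v where uv: "u \<in> U" "v \<notin> U" "(u, v) \<in> E" by blast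
  let ?V = "insert v U"
  have mono: "(E \<inter> U \<times> U)\<^sup>* \<subseteq> (E \<inter> ?V \<times> ?V)\<^sup>*" by (rule rtrancl_mono) blast
  have "connected_subset X E ?V"
  proof (rule connected_subset_if_star[where x = u])
    show "?V \<subseteq> X" using UX uv edges by auto
    show "(u, y) \<in> (E \<inter> ?V \<times> ?V)\<^sup>*" if "y \<in> ?V" for y
      using that mono U(2) uv unfolding connected_subset_def by auto
  qed
  then show ?case using U uv by (intro exI[of _ ?V]) auto
qed

text \<open>The union of balls below is connected because a ball contains the centres of the balls
  that belong to neighbours; so a walk in the index set can be followed from centre to centre.\<close>

lemma connected_Union_balls:
  assumes S: "connected_subset Y E' S"
    and f: "f ` S \<subseteq> X"
    and step: "\<And>s t. s \<in> S \<Longrightarrow> t \<in> S \<Longrightarrow> (s, t) \<in> E' \<Longrightarrow> f t \<in> graph_ball X E (f s) k"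
  shows "connected_subset X E (\<Union>s\<in>S. graph_ball X E (f s) k)"
proof (cases "S = {}")
  case True
  then show ?thesis by (simp add: connected_subset_def)
next
  case False
  then obtain r where r: "r \<in> S" by blast
  let ?U = "\<Union>s\<in>S. graph_ball X E (f s) k"
  have ball: "(f s, y) \<in> (E \<inter> ?U \<times> ?U)\<^sup>*" if "s \<in> S" "y \<in> graph_ball X E (f s) k" for s y
  proof -
    let ?B = "graph_ball X E (f s) k"
    have "f s \<in> X" using that f by blast
    then have "(f s, y) \<in> (E \<inter> ?B \<times> ?B)\<^sup>*"
      using connected_ball center_in_ball that unfolding connected_subset_def by blast
    moreover have "(E \<inter> ?B \<times> ?B)\<^sup>* \<subseteq> (E \<inter> ?U \<times> ?U)\<^sup>*"
      using that by (intro rtrancl_mono) blast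
    ultimately show ?thesis by blast
  qed
  have centers: "s \<in> S \<and> (f r, f s) \<in> (E \<inter> ?U \<times> ?U)\<^sup>*" if "(r, s) \<in> (E' \<inter> S \<times> S)\<^sup>*" for s
    using that
  proof (induction rule: rtrancl_induct)
    case (step s t)
    then have "(f s, f t) \<in> (E \<inter> ?U \<times> ?U)\<^sup>*" using assms(3) ball by blast
    then show ?case using step by auto
  qed (use r in auto)
  show ?thesis
  proof (rule connected_subset_if_star[where x = "f r"])
    show "?U \<subseteq> X" by (auto simp: graph_ball_def)
    fix y assume "y \<in> ?U"
    then obtain s where s: "s \<in> S" "y \<in> graph_ball X E (f s) k" by blast
    have "(f r, f s) \<in> (E \<inter> ?U \<times> ?U)\<^sup>*"
      using centers S r s unfolding connected_subset_def by blast
    then show "(f r, y) \<in> (E \<inter> ?U \<times> ?U)\<^sup>*" using ball[OF s] by (rule rtrancl_trans)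
  qed
qed

end


section \<open>Cayley graphs\<close>

context group
begin

lemma cayley_edges_translate:
  assumes "T \<subseteq> carrier G" "g \<in> carrier G" "(x, y) \<in> cayley_edges G T"
  shows "(g \<otimes> x, g \<otimes> y) \<in> cayley_edges G T"
proof -
  obtain t where t: "x \<in> carrier G" "y \<in> carrier G" "t \<in> T" "y = x \<otimes> t \<or> x = y \<otimes> t"
    using assms(3) unfolding cayley_edges_def by blast
  moreover have "g \<otimes> x \<otimes> t = g \<otimes> (x \<otimes> t)" "g \<otimes> y \<otimes> t = g \<otimes> (y \<otimes> t)"
    using t assms(1,2) by (auto intro: m_assoc)
  ultimately have "g \<otimes> y = g \<otimes> x \<otimes> t \<or> g \<otimes> x = g \<otimes> y \<otimes> t" by metis
  then show ?thesis using t(1-3) assms(2) unfolding cayley_edges_def by auto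
qed

lemma cayley_walk_translate:
  assumes T: "T \<subseteq> carrier G" and g: "g \<in> carrier G"
  shows "(x, y) \<in> cayley_edges G T ^^ n \<Longrightarrow> (g \<otimes> x, g \<otimes> y) \<in> cayley_edges G T ^^ n"
proof (induction n arbitrary: y)
  case (Suc n)
  then show ?case using cayley_edges_translate[OF T g] by auto
qed simp

lemma graph_dist_translate:
  assumes T: "T \<subseteq> carrier G" and [simp]: "g \<in> carrier G" "x \<in> carrier G" "y \<in> carrier G"
  shows "graph_dist (cayley_edges G T) (g \<otimes> x) (g \<otimes> y) = graph_dist (cayley_edges G T) x y"
proof -
  have "(g \<otimes> x, g \<otimes> y) \<in> cayley_edges G T ^^ n \<longleftrightarrow> (x, y) \<in> cayley_edges G T ^^ n" for n
    using cayley_walk_translate[OF T, of g x y n]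
      cayley_walk_translate[OF T, of "inv g" "g \<otimes> x" "g \<otimes> y" n]
    by (auto simp flip: m_assoc)
  then show ?thesis unfolding graph_dist_def by simp
qed

lemma ball_translate:
  assumes T: "T \<subseteq> carrier G" and g: "g \<in> carrier G"
  shows "graph_ball (carrier G) (cayley_edges G T) g k
    = g <# graph_ball (carrier G) (cayley_edges G T) \<one> k"
proof (intro equalityI subsetI)
  fix y assume y: "y \<in> graph_ball (carrier G) (cayley_edges G T) g k"
  then have yc: "y \<in> carrier G" by (simp add: graph_ball_def)
  have "graph_dist (cayley_edges G T) (inv g \<otimes> g) (inv g \<otimes> y) \<le> k"
    using y g yc graph_dist_translate[OF T, of "inv g" g y] by (simp add: graph_ball_def)
  then have "inv g \<otimes> y \<in> graph_ball (carrier G) (cayley_edges G T) \<one> k"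
    using g yc by (simp add: graph_ball_def)
  moreover have "y = g \<otimes> (inv g \<otimes> y)" using g yc by (simp flip: m_assoc)
  ultimately show "y \<in> g <# graph_ball (carrier G) (cayley_edges G T) \<one> k"
    unfolding l_coset_def by blast
next
  fix y assume "y \<in> g <# graph_ball (carrier G) (cayley_edges G T) \<one> k"
  then obtain z where z: "z \<in> carrier G" "graph_dist (cayley_edges G T) \<one> z \<le> k" "y = g \<otimes> z"
    unfolding l_coset_def graph_ball_def by auto
  then show "y \<in> graph_ball (carrier G) (cayley_edges G T) g k"
    using g graph_dist_translate[OF T, of g \<one> z] by (simp add: graph_ball_def)
qed

lemma cayley_edges_finite_degree:
  assumes T: "T \<subseteq> carrier G" and "finite T"
  shows "finite (cayley_edges G T `` {x})"
proof (rule finite_subset)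
  show "cayley_edges G T `` {x} \<subseteq> (\<lambda>t. x \<otimes> t) ` T \<union> (\<lambda>t. x \<otimes> inv t) ` T"
  proof
    fix y assume "y \<in> cayley_edges G T `` {x}"
    then obtain t where t: "x \<in> carrier G" "y \<in> carrier G" "t \<in> T" "y = x \<otimes> t \<or> x = y \<otimes> t"
      unfolding cayley_edges_def by auto
    moreover have "y = x \<otimes> inv t" if "x = y \<otimes> t"
      using that t(2,3) T by (auto simp: m_assoc)
    ultimately show "y \<in> (\<lambda>t. x \<otimes> t) ` T \<union> (\<lambda>t. x \<otimes> inv t) ` T" by blast
  qed
qed (use assms in auto)

text \<open>A word in the generators that represents \<open>inv x \<otimes> y\<close> labels a walk from \<open>x\<close> to \<open>y\<close>.\<close>

lemma cayley_connected_graph: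
  assumes "finite_generating_set G T"
  shows "connected_graph (carrier G) (cayley_edges G T)"
proof
  let ?E = "cayley_edges G T"
  have T: "T \<subseteq> carrier G" and gen: "generate G T = carrier G"
    using assms by (auto simp: finite_generating_set_def)
  show E: "?E \<subseteq> carrier G \<times> carrier G" by (auto simp: cayley_edges_def)
  show sym: "sym ?E" unfolding sym_def cayley_edges_def by blast
  have walk: "h \<in> generate G T \<Longrightarrow> \<forall>g\<in>carrier G. (g, g \<otimes> h) \<in> ?E\<^sup>*" for h
  proof (induction rule: generate.induct)
    case one
    then show ?case by auto
  next
    case (incl h)
    then show ?case using T by (auto simp: cayley_edges_def intro!: r_into_rtrancl)
  next
    case (inv h)
    have "(g, g \<otimes> inv h) \<in> ?E" if "g \<in> carrier G" for g
      using inv that T unfolding cayley_edges_def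
      by (auto simp: m_assoc subset_iff intro!: bexI[of _ h])
    then show ?case by blast
  next
    case (eng h k)
    have hk: "h \<in> carrier G" "k \<in> carrier G" using eng gen by auto
    show ?case
    proof
      fix g assume g: "g \<in> carrier G"
      then have "(g, g \<otimes> h) \<in> ?E\<^sup>*" "(g \<otimes> h, g \<otimes> h \<otimes> k) \<in> ?E\<^sup>*" using eng.IH hk by auto
      then show "(g, g \<otimes> (h \<otimes> k)) \<in> ?E\<^sup>*" using hk g by (simp add: m_assoc)
    qed
  qed
  show "connected_subset (carrier G) ?E (carrier G)"
    unfolding connected_subset_def
  proof (intro conjI ballI subset_refl)
    fix x y assume xy: "x \<in> carrier G" "y \<in> carrier G"
    have "(x, x \<otimes> (inv x \<otimes> y)) \<in> ?E\<^sup>*" using walk xy gen by auto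
    moreover have "?E \<inter> carrier G \<times> carrier G = ?E" using E by blast
    ultimately show "(x, y) \<in> (?E \<inter> carrier G \<times> carrier G)\<^sup>*" using xy by (simp flip: m_assoc)
  qed
qed

lemma finite_cayley_ball:
  assumes "finite_generating_set G T" "x \<in> carrier G"
  shows "finite (graph_ball (carrier G) (cayley_edges G T) x k)"
proof -
  have "\<And>y. finite (cayley_edges G T `` {y})"
    using assms cayley_edges_finite_degree by (auto simp: finite_generating_set_def)
  then show ?thesis
    using connected_graph.finite_ball[OF cayley_connected_graph[OF assms(1)]] assms(2) by blast
qed

lemma finite_subset_ball:
  assumes "finite_generating_set G T" "finite F" "F \<subseteq> carrier G"
  shows "\<exists>k. F \<subseteq> graph_ball (carrier G) (cayley_edges G T) \<one> k"
proof -
  have "F \<subseteq> graph_ball (carrier G) (cayley_edges G T) \<one> (\<Sum>x\<in>F. graph_dist (cayley_edges G T) \<one> x)"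
    using assms by (auto simp: graph_ball_def intro: member_le_sum)
  then show ?thesis ..
qed

end


section \<open>Displacing lamps in a halo product\<close>

lemma halo_subgroup: "halo X G L \<Longrightarrow> S \<subseteq> X \<Longrightarrow> subgroup (L S) G"
  by (simp add: halo_def)

lemma halo_mono: "halo X G L \<Longrightarrow> R \<subseteq> S \<Longrightarrow> S \<subseteq> X \<Longrightarrow> L R \<subseteq> L S"
  by (simp add: halo_def)

text \<open>The group of a halo is generated by the subgroups attached to finite sets, and finite sets are
  directed under inclusion; so each element, and hence each finite set of elements, is supported on
  one finite set.\<close>

lemma halo_finite_support:
  assumes halo: "halo X G L" and "finite V" "V \<subseteq> carrier G"
  shows "\<exists>F. finite F \<and> F \<subseteq> X \<and> V \<subseteq> L F"
proof -
  have single: "\<exists>F. finite F \<and> F \<subseteq> X \<and> g \<in> L F"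
    if "g \<in> generate G (\<Union>{L S | S. S \<subseteq> X \<and> finite S})" for g
    using that
  proof (induction rule: generate.induct)
    case one
    show ?case using halo_subgroup[OF halo, of "{}"] subgroup.one_closed by blast
  next
    case (incl h)
    then show ?case by blast
  next
    case (inv h)
    then obtain S where S: "S \<subseteq> X" "finite S" "h \<in> L S" by blast
    then show ?case
      using subgroup.m_inv_closed[OF halo_subgroup[OF halo S(1)] S(3)] by blast
  next
    case (eng h k)
    then obtain R S where RS: "finite R" "R \<subseteq> X" "h \<in> L R" "finite S" "S \<subseteq> X" "k \<in> L S" by blast
    then have "h \<in> L (R \<union> S)" "k \<in> L (R \<union> S)"
      using halo_mono[OF halo, of R "R \<union> S"] halo_mono[OF halo, of S "R \<union> S"] by auto
    then show ?case
      using RS subgroup.m_closed[OF halo_subgroup[OF halo, of "R \<union> S"]]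
      by (intro exI[of _ "R \<union> S"]) simp
  qed
  have "carrier G = L X" using halo by (simp add: halo_def)
  also have "L X = generate G (\<Union>{L S | S. S \<subseteq> X \<and> finite S})"
    using halo unfolding halo_def by (elim conjE)
  finally have "\<forall>g\<in>V. \<exists>F. finite F \<and> F \<subseteq> X \<and> g \<in> L F" using single assms(3) by blast
  then obtain F where F: "\<And>g. g \<in> V \<Longrightarrow> finite (F g) \<and> F g \<subseteq> X \<and> g \<in> L (F g)" by metis
  have "g \<in> L (\<Union>(F ` V))" if "g \<in> V" for g
    using that F halo_mono[OF halo, of "F g" "\<Union>(F ` V)"] by blast
  then show ?thesis using F assms(2) by (intro exI[of _ "\<Union>(F ` V)"]) blast
qed

locale halo_prod =
  fixes H :: "('a, 'm) monoid_scheme" and G :: "('g, 'n) monoid_scheme"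
    and L :: "'a set \<Rightarrow> 'g set" and \<phi> :: "'a \<Rightarrow> 'g \<Rightarrow> 'g"
  assumes halo_product: "halo_product H G L \<phi>"
begin

lemma group_base: "group H" and halo_base: "halo (carrier H) G L" and group_lamps: "group G"
  using halo_product by (auto simp: halo_product_def halo_def)

lemma L_subset_carrier: "S \<subseteq> carrier H \<Longrightarrow> L S \<subseteq> carrier G"
  using halo_subgroup[OF halo_base] subgroup.subset by blast

lemma action_image: "h \<in> carrier H \<Longrightarrow> S \<subseteq> carrier H \<Longrightarrow> \<phi> h ` L S = L (h <#\<^bsub>H\<^esub> S)"
  using halo_product by (simp add: halo_product_def halo_action_def)

lemma action_auto: "h \<in> carrier H \<Longrightarrow> \<phi> h \<in> auto G"
  using halo_product
  by (auto simp: halo_product_def halo_action_def hom_def AutoGroup_def)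

lemma action_hom: "h \<in> carrier H \<Longrightarrow> \<phi> h \<in> hom G G"
  using action_auto by (simp add: auto_def)

lemma action_bij: "h \<in> carrier H \<Longrightarrow> bij_betw (\<phi> h) (carrier G) (carrier G)"
  using action_auto by (auto simp: auto_def Bij_def)

lemma action_closed [simp]: "h \<in> carrier H \<Longrightarrow> c \<in> carrier G \<Longrightarrow> \<phi> h c \<in> carrier G"
  using action_hom by (auto simp: hom_def)

lemma action_mult:
  "h \<in> carrier H \<Longrightarrow> c \<in> carrier G \<Longrightarrow> d \<in> carrier G \<Longrightarrow> \<phi> h (c \<otimes>\<^bsub>G\<^esub> d) = \<phi> h c \<otimes>\<^bsub>G\<^esub> \<phi> h d"
  using action_hom by (auto simp: hom_def)

lemma action_action:
  assumes "h \<in> carrier H" "k \<in> carrier H" "c \<in> carrier G"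
  shows "\<phi> (h \<otimes>\<^bsub>H\<^esub> k) c = \<phi> h (\<phi> k c)"
proof -
  have "\<phi> \<in> hom H (AutoGroup G)"
    using halo_product by (simp add: halo_product_def halo_action_def)
  then have "\<phi> (h \<otimes>\<^bsub>H\<^esub> k) = \<phi> h \<otimes>\<^bsub>AutoGroup G\<^esub> \<phi> k" using assms by (auto simp: hom_def)
  also have "\<dots> = compose (carrier G) (\<phi> h) (\<phi> k)"
    using assms action_auto by (simp add: AutoGroup_def BijGroup_def auto_def)
  finally show ?thesis using assms by (simp add: compose_def)
qed

lemma action_one:
  assumes "c \<in> carrier G"
  shows "\<phi> \<one>\<^bsub>H\<^esub> c = c"
proof -
  interpret H: group H by (rule group_base)
  have "\<phi> \<one>\<^bsub>H\<^esub> (\<phi> \<one>\<^bsub>H\<^esub> c) = \<phi> \<one>\<^bsub>H\<^esub> c"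
    using action_action[of "\<one>\<^bsub>H\<^esub>" "\<one>\<^bsub>H\<^esub>" c] assms by simp
  then show ?thesis
    using inj_onD[OF bij_betw_imp_inj_on[OF action_bij[OF H.one_closed]], of "\<phi> \<one>\<^bsub>H\<^esub> c" c] assms
    by simp
qed

abbreviation P where "P \<equiv> semidirect_product G H \<phi>"

lemma carrier_P: "carrier P = carrier G \<times> carrier H"
  and mult_P: "(c, p) \<otimes>\<^bsub>P\<^esub> (d, q) = (c \<otimes>\<^bsub>G\<^esub> \<phi> p d, p \<otimes>\<^bsub>H\<^esub> q)"
  and one_P: "\<one>\<^bsub>P\<^esub> = (\<one>\<^bsub>G\<^esub>, \<one>\<^bsub>H\<^esub>)"
  by (simp_all add: semidirect_product_def)

lemma group_P: "group P"
proof -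
  interpret H: group H by (rule group_base)
  interpret G: group G by (rule group_lamps)
  show ?thesis
  proof (rule groupI)
    fix x assume "x \<in> carrier P"
    then obtain c p where x: "x = (c, p)" "c \<in> carrier G" "p \<in> carrier H" by (auto simp: carrier_P)
    have "\<phi> (inv\<^bsub>H\<^esub> p) (inv\<^bsub>G\<^esub> c) \<otimes>\<^bsub>G\<^esub> \<phi> (inv\<^bsub>H\<^esub> p) c = \<phi> (inv\<^bsub>H\<^esub> p) \<one>\<^bsub>G\<^esub>"
      using x by (simp flip: action_mult)
    also have "\<dots> = \<one>\<^bsub>G\<^esub>" using x action_hom hom_one group_lamps by blast
    finally show "\<exists>y\<in>carrier P. y \<otimes>\<^bsub>P\<^esub> x = \<one>\<^bsub>P\<^esub>"
      using x by (intro bexI[of _ "(\<phi> (inv\<^bsub>H\<^esub> p) (inv\<^bsub>G\<^esub> c), inv\<^bsub>H\<^esub> p)"])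
        (auto simp: carrier_P mult_P one_P)
  qed (auto simp: carrier_P mult_P one_P action_one action_mult action_action G.m_assoc H.m_assoc)
qed

text \<open>In \<open>semidirect_product G H \<phi>\<close> the element \<open>(c \<otimes> \<phi> p d, p)\<close> is the right multiple of \<open>(c, p)\<close> by
  \<open>(d, \<one>)\<close>, and word metrics are invariant under left translations.\<close>

lemma dist_lamp_displacement:
  assumes T: "T \<subseteq> carrier P" and "c \<in> carrier G" "p \<in> carrier H" "d \<in> carrier G"
  shows "word_dist P T (c, p) (c \<otimes>\<^bsub>G\<^esub> \<phi> p d, p) = word_dist P T \<one>\<^bsub>P\<^esub> (d, \<one>\<^bsub>H\<^esub>)"
proof -
  interpret H: group H by (rule group_base)
  interpret G: group G by (rule group_lamps)
  interpret P: group P by (rule group_P)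
  have "(c, p) \<otimes>\<^bsub>P\<^esub> (d, \<one>\<^bsub>H\<^esub>) = (c \<otimes>\<^bsub>G\<^esub> \<phi> p d, p)" "(c, p) \<otimes>\<^bsub>P\<^esub> \<one>\<^bsub>P\<^esub> = (c, p)"
    using assms P.r_one[of "(c, p)"] by (simp_all add: mult_P carrier_P)
  then show ?thesis
    using P.graph_dist_translate[OF T, of "(c, p)" "\<one>\<^bsub>P\<^esub>" "(d, \<one>\<^bsub>H\<^esub>)"] assms
      P.one_closed
    by (simp add: word_dist_def carrier_P)
qed

text \<open>The action of \<open>p\<close> identifies \<open>L R\<close> with the lamp group of the translate of \<open>R\<close> by \<open>p\<close>, so a
  displacement at \<open>p\<close> has the same size as a displacement at the identity by one of the finitely many
  elements of \<open>L R\<close>.\<close>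

lemma finite_local_displacements:
  assumes T: "T \<subseteq> carrier P" and R: "R \<subseteq> carrier H" "finite (L R)"
  shows "\<exists>V. finite V \<and> (\<forall>c\<in>carrier G. \<forall>p\<in>carrier H. \<forall>d\<in>L (p <#\<^bsub>H\<^esub> R).
    word_dist P T (c, p) (c \<otimes>\<^bsub>G\<^esub> d, p) \<in> V)"
proof (intro exI conjI ballI)
  show "finite ((\<lambda>d. word_dist P T \<one>\<^bsub>P\<^esub> (d, \<one>\<^bsub>H\<^esub>)) ` L R)" using R by simp
  fix c p d assume cp: "c \<in> carrier G" "p \<in> carrier H" and "d \<in> L (p <#\<^bsub>H\<^esub> R)"
  then obtain e where e: "e \<in> L R" "d = \<phi> p e" using action_image R by blast
  then have "e \<in> carrier G" using L_subset_carrier R by blast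
  then show "word_dist P T (c, p) (c \<otimes>\<^bsub>G\<^esub> d, p) \<in> (\<lambda>d. word_dist P T \<one>\<^bsub>P\<^esub> (d, \<one>\<^bsub>H\<^esub>)) ` L R"
    using dist_lamp_displacement[OF T cp] e by auto
qed

text \<open>Up to a translation that carries the arrow to the identity, a displacement of size at most \<open>K\<close> is
  one of the finitely many elements of a ball, and these have a common finite support \<open>F\<close>.\<close>

lemma bounded_displacements_are_local:
  assumes T: "finite_generating_set P T"
  shows "\<exists>F. finite F \<and> F \<subseteq> carrier H \<and> (\<forall>c\<in>carrier G. \<forall>d\<in>carrier G. \<forall>p\<in>carrier H.
    word_dist P T (c, p) (d, p) \<le> K \<longrightarrow> inv\<^bsub>G\<^esub> c \<otimes>\<^bsub>G\<^esub> d \<in> L (p <#\<^bsub>H\<^esub> F))"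
proof -
  interpret H: group H by (rule group_base)
  interpret G: group G by (rule group_lamps)
  interpret P: group P by (rule group_P)
  let ?ball = "graph_ball (carrier P) (cayley_edges P T) \<one>\<^bsub>P\<^esub> (nat \<lfloor>K\<rfloor>)"
  have fin: "finite (fst ` ?ball)" using P.finite_cayley_ball[OF T] by simp
  have sub: "fst ` ?ball \<subseteq> carrier G" by (auto simp: graph_ball_def carrier_P)
  obtain F where F: "finite F" "F \<subseteq> carrier H" "fst ` ?ball \<subseteq> L F"
    using halo_finite_support[OF halo_base fin sub] by blast
  have "inv\<^bsub>G\<^esub> c \<otimes>\<^bsub>G\<^esub> d \<in> L (p <#\<^bsub>H\<^esub> F)"
    if cdp: "c \<in> carrier G" "d \<in> carrier G" "p \<in> carrier H" and K: "word_dist P T (c, p) (d, p) \<le> K"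
    for c d p
  proof -
    have "inv\<^bsub>G\<^esub> c \<otimes>\<^bsub>G\<^esub> d \<in> \<phi> p ` carrier G" using action_bij cdp by (simp add: bij_betw_def)
    then obtain e where e: "e \<in> carrier G" "inv\<^bsub>G\<^esub> c \<otimes>\<^bsub>G\<^esub> d = \<phi> p e" by blast
    have "d = c \<otimes>\<^bsub>G\<^esub> \<phi> p e" using cdp by (simp flip: e(2) G.m_assoc)
    then have "word_dist P T \<one>\<^bsub>P\<^esub> (e, \<one>\<^bsub>H\<^esub>) \<le> K"
      using K dist_lamp_displacement[of T c p e] T cdp e
      by (simp add: finite_generating_set_def)
    then have "(e, \<one>\<^bsub>H\<^esub>) \<in> ?ball"
      using e by (auto simp: graph_ball_def word_dist_def carrier_P le_nat_floor)
    then have "e \<in> L F" using F by force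
    then show ?thesis using action_image cdp F e by blast
  qed
  then show ?thesis using F by blast
qed

end


section \<open>The image of a lamp group under an aptolic coarse embedding\<close>

text \<open>A control function of a coarse embedding need not be monotone or bounded on bounded sets; a bound
  exists because only finitely many distances are considered.\<close>

lemma coarse_embedding_bounded:
  assumes "coarse_embedding X dX Y dY f" "finite V"
  shows "\<exists>K. \<forall>x\<in>X. \<forall>y\<in>X. dX x y \<in> V \<longrightarrow> dY (f x) (f y) \<le> K"
proof -
  obtain \<sigma> :: "real \<Rightarrow> real" where \<sigma>: "\<And>x y. x \<in> X \<Longrightarrow> y \<in> X \<Longrightarrow> dY (f x) (f y) \<le> \<sigma> (dX x y)"
    using assms unfolding coarse_embedding_def by blast
  have "dY (f x) (f y) \<le> Max (\<sigma> ` V)" if "x \<in> X" "y \<in> X" "dX x y \<in> V" for x y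
    using \<sigma>[OF that(1,2)] that assms(2) by (meson Max_ge finite_imageI image_eqI order_trans)
  then show ?thesis by blast
qed

text \<open>The quotient \<open>(\<alpha> c)\<inverse> \<alpha> (c d)\<close> is a cocycle in \<open>d\<close>: its value at a product is a product of two values,
  at different base points \<open>c\<close>. Quantifying over all base points lets membership in the subgroup
  \<open>U\<close> pass from \<open>Z\<close> to the group that \<open>Z\<close> generates.\<close>

lemma displacement_generate:
  assumes "group G" "group G'" and \<alpha>: "\<alpha> \<in> carrier G \<rightarrow> carrier G'"
    and U: "subgroup U G'" and Z: "Z \<subseteq> carrier G"
    and Z_inv: "\<And>d. d \<in> Z \<Longrightarrow> inv\<^bsub>G\<^esub> d \<in> Z"
    and disp: "\<And>c d. c \<in> carrier G \<Longrightarrow> d \<in> Z \<Longrightarrow> inv\<^bsub>G'\<^esub> (\<alpha> c) \<otimes>\<^bsub>G'\<^esub> \<alpha> (c \<otimes>\<^bsub>G\<^esub> d) \<in> U"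
    and d: "d \<in> generate G Z"
  shows "\<forall>c\<in>carrier G. inv\<^bsub>G'\<^esub> (\<alpha> c) \<otimes>\<^bsub>G'\<^esub> \<alpha> (c \<otimes>\<^bsub>G\<^esub> d) \<in> U"
proof -
  interpret G: group G by fact
  interpret G': group G' by fact
  have \<alpha>_closed [simp]: "\<alpha> c \<in> carrier G'" if "c \<in> carrier G" for c using that \<alpha> by blast
  show ?thesis
    using d
  proof (induction rule: generate.induct)
    case one
    then show ?case using U by (simp add: subgroup.one_closed)
  next
    case (incl h)
    then show ?case using disp by blast
  next
    case (inv h)
    then show ?case using disp Z_inv by blast
  next
    case (eng h k)
    have hk: "h \<in> carrier G" "k \<in> carrier G" using eng.hyps G.generate_incl[OF Z] by auto
    show ?case
    proof
      fix c assume c: "c \<in> carrier G"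
      \<comment> \<open>The cocycle identity, with the second factor taken at the base point \<open>c h\<close>.\<close>
      have "inv\<^bsub>G'\<^esub> (\<alpha> c) \<otimes>\<^bsub>G'\<^esub> \<alpha> (c \<otimes>\<^bsub>G\<^esub> h)
          \<otimes>\<^bsub>G'\<^esub> (inv\<^bsub>G'\<^esub> (\<alpha> (c \<otimes>\<^bsub>G\<^esub> h)) \<otimes>\<^bsub>G'\<^esub> \<alpha> (c \<otimes>\<^bsub>G\<^esub> h \<otimes>\<^bsub>G\<^esub> k)) \<in> U"
        using eng.IH c hk by (intro subgroup.m_closed[OF U, of "_ \<otimes>\<^bsub>G'\<^esub> \<alpha> (c \<otimes>\<^bsub>G\<^esub> h)"]) auto
      also have "inv\<^bsub>G'\<^esub> (\<alpha> c) \<otimes>\<^bsub>G'\<^esub> \<alpha> (c \<otimes>\<^bsub>G\<^esub> h)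
          \<otimes>\<^bsub>G'\<^esub> (inv\<^bsub>G'\<^esub> (\<alpha> (c \<otimes>\<^bsub>G\<^esub> h)) \<otimes>\<^bsub>G'\<^esub> \<alpha> (c \<otimes>\<^bsub>G\<^esub> h \<otimes>\<^bsub>G\<^esub> k))
        = inv\<^bsub>G'\<^esub> (\<alpha> c) \<otimes>\<^bsub>G'\<^esub> ((\<alpha> (c \<otimes>\<^bsub>G\<^esub> h) \<otimes>\<^bsub>G'\<^esub> inv\<^bsub>G'\<^esub> (\<alpha> (c \<otimes>\<^bsub>G\<^esub> h))) \<otimes>\<^bsub>G'\<^esub> \<alpha> (c \<otimes>\<^bsub>G\<^esub> h \<otimes>\<^bsub>G\<^esub> k))"
        using c hk by (simp only: G'.m_assoc G'.inv_closed G'.m_closed G.m_closed \<alpha>_closed)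
      also have "\<dots> = inv\<^bsub>G'\<^esub> (\<alpha> c) \<otimes>\<^bsub>G'\<^esub> \<alpha> (c \<otimes>\<^bsub>G\<^esub> (h \<otimes>\<^bsub>G\<^esub> k))"
        using c hk by (simp add: G.m_assoc)
      finally show "inv\<^bsub>G'\<^esub> (\<alpha> c) \<otimes>\<^bsub>G'\<^esub> \<alpha> (c \<otimes>\<^bsub>G\<^esub> (h \<otimes>\<^bsub>G\<^esub> k)) \<in> U" .
    qed
  qed
qed

lemma card_le_of_displacement:
  assumes "group G'" and \<alpha>: "\<alpha> \<in> Y \<rightarrow> carrier G'" "inj_on \<alpha> Y"
    and U: "subgroup U G'" "finite U" and g: "g \<in> carrier G'"
    and disp: "\<And>c. c \<in> Y \<Longrightarrow> inv\<^bsub>G'\<^esub> g \<otimes>\<^bsub>G'\<^esub> \<alpha> c \<in> U"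
  shows "card Y \<le> card U"
proof (rule card_inj_on_le)
  interpret G': group G' by fact
  show "inj_on (\<lambda>c. inv\<^bsub>G'\<^esub> g \<otimes>\<^bsub>G'\<^esub> \<alpha> c) Y"
    using \<alpha> g by (auto simp: inj_on_def Pi_iff)
qed (use disp U in auto)

text \<open>The finite set \<open>F\<close> does not depend on \<open>S\<close>: the change of the image of a lamp configuration under
  one factor is confined to the translate of \<open>F\<close> to the place where that factor acts.\<close>

lemma aptolic_lamp_image:
  assumes A: "halo_prod A GM M \<phi>" and B: "halo_prod B GN N \<psi>"
    and TA: "finite_generating_set A TA"
    and TMA: "finite_generating_set (semidirect_product GM A \<phi>) TMA"
    and TNB: "finite_generating_set (semidirect_product GN B \<psi>) TNB"
    and coarse: "coarse_embedding
       (carrier (semidirect_product GM A \<phi>)) (word_dist (semidirect_product GM A \<phi>) TMA)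
       (carrier (semidirect_product GN B \<psi>)) (word_dist (semidirect_product GN B \<psi>) TNB) \<rho>"
    and \<rho>: "\<forall>c\<in>carrier GM. \<forall>p\<in>carrier A. \<rho> (c, p) = (\<alpha> c, \<beta> p)"
    and \<alpha>: "\<alpha> \<in> carrier GM \<rightarrow> carrier GN" and \<beta>: "\<beta> \<in> carrier A \<rightarrow> carrier B"
    and charming: "charming (carrier A) (cayley_edges A TA) GM M"
    and growth: "lamp_growth_sequence (carrier A) (cayley_edges A TA) M \<Lambda>"
  shows "\<exists>F. finite F \<and> F \<subseteq> carrier B \<and>
    (\<forall>S W c. connected_subset (carrier A) (cayley_edges A TA) S \<longrightarrow> W \<subseteq> carrier B \<longrightarrow>
      (\<Union>s\<in>S. \<beta> s <#\<^bsub>B\<^esub> F) \<subseteq> W \<longrightarrow> c \<in> M S \<longrightarrow>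
      inv\<^bsub>GN\<^esub> (\<alpha> \<one>\<^bsub>GM\<^esub>) \<otimes>\<^bsub>GN\<^esub> \<alpha> c \<in> N W)"
proof -
  interpret A: halo_prod A GM M \<phi> by (rule A)
  interpret B: halo_prod B GN N \<psi> by (rule B)
  interpret A': group A by (rule A.group_base)
  interpret GM': group GM by (rule A.group_lamps)
  interpret GA: connected_graph "carrier A" "cayley_edges A TA"
    by (rule A'.cayley_connected_graph[OF TA])
  obtain D where D: "\<And>S. connected_subset (carrier A) (cayley_edges A TA) S \<Longrightarrow>
      M S \<subseteq> generate GM (\<Union>s\<in>S. M (graph_ball (carrier A) (cayley_edges A TA) s D))"
    using charming unfolding charming_def by blast
  let ?ball = "\<lambda>s. graph_ball (carrier A) (cayley_edges A TA) s D"
  have ball_sub: "?ball s \<subseteq> carrier A" for s by (auto simp: graph_ball_def)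
  have ball: "?ball s = s <#\<^bsub>A\<^esub> ?ball \<one>\<^bsub>A\<^esub>" if "s \<in> carrier A" for s
    by (rule A'.ball_translate) (use TA that in \<open>simp_all add: finite_generating_set_def\<close>)
  have fin: "finite (M (?ball \<one>\<^bsub>A\<^esub>))"
    using growth GA.connected_ball[OF A'.one_closed] A'.finite_cayley_ball[OF TA A'.one_closed]
    unfolding lamp_growth_sequence_def by blast
  have "TMA \<subseteq> carrier A.P" using TMA by (simp add: finite_generating_set_def)
  from A.finite_local_displacements[OF this ball_sub fin]
  obtain V where V: "finite V" "\<And>c p d. c \<in> carrier GM \<Longrightarrow> p \<in> carrier A \<Longrightarrow> d \<in> M (?ball p) \<Longrightarrow>
      word_dist A.P TMA (c, p) (c \<otimes>\<^bsub>GM\<^esub> d, p) \<in> V"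
    by (metis ball)
  obtain K where K: "\<And>x y. x \<in> carrier A.P \<Longrightarrow> y \<in> carrier A.P \<Longrightarrow> word_dist A.P TMA x y \<in> V \<Longrightarrow>
      word_dist B.P TNB (\<rho> x) (\<rho> y) \<le> K"
    using coarse_embedding_bounded[OF coarse V(1)] by blast
  obtain F where F: "finite F" "F \<subseteq> carrier B"
    "\<forall>c\<in>carrier GN. \<forall>d\<in>carrier GN. \<forall>p\<in>carrier B.
      word_dist B.P TNB (c, p) (d, p) \<le> K \<longrightarrow> inv\<^bsub>GN\<^esub> c \<otimes>\<^bsub>GN\<^esub> d \<in> N (p <#\<^bsub>B\<^esub> F)"
    using B.bounded_displacements_are_local[OF TNB, of K] by (elim exE conjE) (rule that)
  have main: "inv\<^bsub>GN\<^esub> (\<alpha> \<one>\<^bsub>GM\<^esub>) \<otimes>\<^bsub>GN\<^esub> \<alpha> c \<in> N W"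
    if S: "connected_subset (carrier A) (cayley_edges A TA) S" and W: "W \<subseteq> carrier B"
      and FW: "(\<Union>s\<in>S. \<beta> s <#\<^bsub>B\<^esub> F) \<subseteq> W" and c: "c \<in> M S" for S W c
  proof -
    let ?Z = "\<Union>s\<in>S. M (?ball s)"
    have SA: "S \<subseteq> carrier A" using S by (simp add: connected_subset_def)
    have Z: "?Z \<subseteq> carrier GM" using A.L_subset_carrier[OF ball_sub] by blast
    have disp: "inv\<^bsub>GN\<^esub> (\<alpha> b) \<otimes>\<^bsub>GN\<^esub> \<alpha> (b \<otimes>\<^bsub>GM\<^esub> d) \<in> N W"
      if b: "b \<in> carrier GM" and "d \<in> ?Z" for b d
    proof -
      obtain s where s: "s \<in> S" "d \<in> M (?ball s)" using \<open>d \<in> ?Z\<close> by blast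
      have sA: "s \<in> carrier A" and dc: "d \<in> carrier GM" using s SA Z by auto
      have "word_dist B.P TNB (\<rho> (b, s)) (\<rho> (b \<otimes>\<^bsub>GM\<^esub> d, s)) \<le> K"
        using K V(2)[OF b sA s(2)] b dc sA by (simp add: A.carrier_P)
      then have "inv\<^bsub>GN\<^esub> (\<alpha> b) \<otimes>\<^bsub>GN\<^esub> \<alpha> (b \<otimes>\<^bsub>GM\<^esub> d) \<in> N (\<beta> s <#\<^bsub>B\<^esub> F)"
        using b dc sA \<alpha> \<beta> by (intro F(3)[rule_format]) (auto simp: \<rho>)
      moreover have "\<beta> s <#\<^bsub>B\<^esub> F \<subseteq> W" using FW s by blast
      ultimately show ?thesis using halo_mono[OF B.halo_base _ W] by blast
    qed
    have "\<forall>b\<in>carrier GM. inv\<^bsub>GN\<^esub> (\<alpha> b) \<otimes>\<^bsub>GN\<^esub> \<alpha> (b \<otimes>\<^bsub>GM\<^esub> c) \<in> N W"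
    proof (rule displacement_generate[OF A.group_lamps B.group_lamps \<alpha>
          halo_subgroup[OF B.halo_base W] Z])
      show "inv\<^bsub>GM\<^esub> d \<in> ?Z" if "d \<in> ?Z" for d
        using that subgroup.m_inv_closed[OF halo_subgroup[OF A.halo_base ball_sub]] by blast
      show "c \<in> generate GM ?Z" using D[OF S] c by blast
    qed (fact disp)
    moreover have "c \<in> carrier GM" using c A.L_subset_carrier[OF SA] by blast
    ultimately show ?thesis using GM'.one_closed by (metis GM'.l_one)
  qed
  show ?thesis
    using F(1,2) by (intro exI[of _ F] conjI allI impI) (auto intro: main)
qed

text \<open>The union of the balls is too irregular for its size to be known, but it is at most the size of
  one ball times that of \<open>S\<close>; enlarging the union to exactly this size determines the order of the
  lamp group.\<close>

lemma lamp_group_over_ball_union: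
  assumes B: "halo_prod B GN N \<psi>" and TB: "finite_generating_set B TB"
    and inf: "infinite (carrier B)"
    and growth: "lamp_growth_sequence (carrier B) (cayley_edges B TB) N \<Lambda>"
    and S: "finite S" "S \<noteq> {}" and \<beta>: "\<beta> \<in> S \<rightarrow> carrier B"
    and conn: "connected_subset (carrier B) (cayley_edges B TB)
      (\<Union>s\<in>S. graph_ball (carrier B) (cayley_edges B TB) (\<beta> s) k)"
  shows "\<exists>W. W \<subseteq> carrier B \<and> (\<Union>s\<in>S. graph_ball (carrier B) (cayley_edges B TB) (\<beta> s) k) \<subseteq> W \<and>
    finite (N W) \<and>
    card (N W) = \<Lambda> (card (graph_ball (carrier B) (cayley_edges B TB) \<one>\<^bsub>B\<^esub> k) * card S)"
proof -
  interpret B: halo_prod B GN N \<psi> by (rule B)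
  interpret B': group B by (rule B.group_base)
  interpret GB: connected_graph "carrier B" "cayley_edges B TB"
    by (rule B'.cayley_connected_graph[OF TB])
  let ?ball = "\<lambda>b. graph_ball (carrier B) (cayley_edges B TB) b k"
  let ?U = "\<Union>s\<in>S. ?ball (\<beta> s)"
  have fin: "finite (?ball b)" if "b \<in> carrier B" for b using B'.finite_cayley_ball[OF TB that] .
  have card_ball: "card (?ball b) \<le> card (?ball \<one>\<^bsub>B\<^esub>)" if "b \<in> carrier B" for b
  proof -
    have "?ball b = b <#\<^bsub>B\<^esub> ?ball \<one>\<^bsub>B\<^esub>"
      by (rule B'.ball_translate) (use TB that in \<open>simp_all add: finite_generating_set_def\<close>)
    also have "\<dots> = (\<lambda>h. b \<otimes>\<^bsub>B\<^esub> h) ` ?ball \<one>\<^bsub>B\<^esub>" by (auto simp: l_coset_def)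
    finally show ?thesis using card_image_le[OF fin[OF B'.one_closed]] by simp
  qed
  have "card ?U \<le> (\<Sum>s\<in>S. card (?ball (\<beta> s)))" using S by (intro card_UN_le) auto
  also have "\<dots> \<le> (\<Sum>s\<in>S. card (?ball \<one>\<^bsub>B\<^esub>))" using card_ball \<beta> by (intro sum_mono) auto
  finally have "card ?U \<le> card (?ball \<one>\<^bsub>B\<^esub>) * card S" by (simp add: mult.commute)
  moreover have "finite ?U" using fin S \<beta> by blast
  moreover have "?U \<noteq> {}" using S \<beta> GB.center_in_ball by blast
  ultimately obtain W where W: "?U \<subseteq> W" "connected_subset (carrier B) (cayley_edges B TB) W"
      "finite W" "card W = card (?ball \<one>\<^bsub>B\<^esub>) * card S"
    using GB.connected_superset[OF inf conn] by metis
  then have "finite (N W)" "card (N W) = \<Lambda> (card (?ball \<one>\<^bsub>B\<^esub>) * card S)"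
    using growth unfolding lamp_growth_sequence_def by auto
  then show ?thesis using W(1,2) by (auto simp: connected_subset_def)
qed

theorem theorem1p11:
  fixes A :: "('a, 'ma) monoid_scheme" and B :: "('b, 'mb) monoid_scheme"
    and GM :: "('g, 'mg) monoid_scheme" and GN :: "('k, 'mk) monoid_scheme"
    and M :: "'a set \<Rightarrow> 'g set" and N :: "'b set \<Rightarrow> 'k set"
    and \<phi> :: "'a \<Rightarrow> 'g \<Rightarrow> 'g" and \<psi> :: "'b \<Rightarrow> 'k \<Rightarrow> 'k"
    and TA :: "'a set" and TB :: "'b set"
    and TMA :: "('g \<times> 'a) set" and TNB :: "('k \<times> 'b) set"
    and \<Lambda>\<^sub>M \<Lambda>\<^sub>N :: "nat \<Rightarrow> nat"
  assumes "halo_product A GM M \<phi>" and "halo_product B GN N \<psi>"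
    and "finite_generating_set A TA" and "finite_generating_set B TB"
    and "finite_generating_set (semidirect_product GM A \<phi>) TMA"
    and "finite_generating_set (semidirect_product GN B \<psi>) TNB"
    and "infinite (carrier A)" and "infinite (carrier B)"
    and "charming (carrier A) (cayley_edges A TA) GM M"
    and "charming (carrier B) (cayley_edges B TB) GN N"
    and "locally_finite_group GM" and "locally_finite_group GN"
    and "lamp_growth_sequence (carrier A) (cayley_edges A TA) M \<Lambda>\<^sub>M"
    and "lamp_growth_sequence (carrier B) (cayley_edges B TB) N \<Lambda>\<^sub>N"
    and "\<exists>\<rho>. aptolic_coarse_embedding A TA GM \<phi> TMA B TB GN \<psi> TNB \<rho>"
  shows "dominated \<Lambda>\<^sub>M \<Lambda>\<^sub>N"
proof -
  interpret A: halo_prod A GM M \<phi> using assms(1) by unfold_locales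
  interpret B: halo_prod B GN N \<psi> using assms(2) by unfold_locales
  interpret A': group A by (rule A.group_base)
  interpret B': group B by (rule B.group_base)
  interpret GM': group GM by (rule A.group_lamps)
  let ?EA = "cayley_edges A TA" and ?EB = "cayley_edges B TB"
  interpret GA: connected_graph "carrier A" ?EA by (rule A'.cayley_connected_graph[OF assms(3)])
  interpret GB: connected_graph "carrier B" ?EB by (rule B'.cayley_connected_graph[OF assms(4)])
  obtain \<rho> where "aptolic_coarse_embedding A TA GM \<phi> TMA B TB GN \<psi> TNB \<rho>"
    using assms(15) by (rule exE)
  then obtain \<alpha> \<beta> where
    coarse: "coarse_embedding (carrier A.P) (word_dist A.P TMA) (carrier B.P) (word_dist B.P TNB) \<rho>"
    and \<alpha>: "\<alpha> \<in> carrier GM \<rightarrow> carrier GN" "inj_on \<alpha> (carrier GM)"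
    and \<beta>_coarse: "coarse_embedding (carrier A) (word_dist A TA) (carrier B) (word_dist B TB) \<beta>"
    and \<rho>: "\<forall>c\<in>carrier GM. \<forall>p\<in>carrier A. \<rho> (c, p) = (\<alpha> c, \<beta> p)"
    unfolding aptolic_coarse_embedding_def by (elim conjE exE) simp
  have \<beta>: "\<beta> \<in> carrier A \<rightarrow> carrier B" using \<beta>_coarse by (simp add: coarse_embedding_def)
  obtain F where F: "finite F" "F \<subseteq> carrier B"
    and image: "\<forall>S W c. connected_subset (carrier A) ?EA S \<longrightarrow> W \<subseteq> carrier B \<longrightarrow>
      (\<Union>s\<in>S. \<beta> s <#\<^bsub>B\<^esub> F) \<subseteq> W \<longrightarrow> c \<in> M S \<longrightarrow>
      inv\<^bsub>GN\<^esub> (\<alpha> \<one>\<^bsub>GM\<^esub>) \<otimes>\<^bsub>GN\<^esub> \<alpha> c \<in> N W"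
    using aptolic_lamp_image[OF A.halo_prod_axioms B.halo_prod_axioms assms(3,5,6) coarse \<rho> \<alpha>(1) \<beta>
        assms(9,13)]
    by (elim exE conjE) (rule that)
  obtain r where r: "F \<subseteq> graph_ball (carrier B) ?EB \<one>\<^bsub>B\<^esub> r"
    using B'.finite_subset_ball[OF assms(4) F] by blast
  \<comment> \<open>The distance 0 occurs here because a generating set may contain the identity, so that the Cayley
    graph has loops.\<close>
  obtain K where K: "\<And>x y. x \<in> carrier A \<Longrightarrow> y \<in> carrier A \<Longrightarrow> word_dist A TA x y \<in> {0, 1} \<Longrightarrow>
      word_dist B TB (\<beta> x) (\<beta> y) \<le> K"
    using coarse_embedding_bounded[OF \<beta>_coarse, of "{0, 1}"] by blast
  \<comment> \<open>Radius \<open>r\<close> makes the balls absorb the translates of \<open>F\<close>, radius \<open>K\<close> makes the balls around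
    the images of neighbours overlap.\<close>
  define k where "k = max r (nat \<lfloor>K\<rfloor>)"
  let ?ball = "\<lambda>b. graph_ball (carrier B) ?EB b k"
  have step: "\<beta> t \<in> ?ball (\<beta> s)" if "(s, t) \<in> ?EA" for s t
  proof -
    have st: "s \<in> carrier A" "t \<in> carrier A" using that GA.edges by auto
    have "graph_dist ?EA s t \<le> 1" using that GA.graph_dist_le_iff[OF st, of 1] by fastforce
    then have "word_dist A TA s t \<in> {0, 1}" by (auto simp: word_dist_def le_Suc_eq)
    then have "word_dist B TB (\<beta> s) (\<beta> t) \<le> K" using K st by blast
    then show ?thesis
      using st \<beta> by (auto simp: graph_ball_def word_dist_def k_def le_max_iff_disj le_nat_floor)
  qed
  have near: "\<beta> s <#\<^bsub>B\<^esub> F \<subseteq> ?ball (\<beta> s)" if "s \<in> carrier A" for s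
  proof -
    have "?ball (\<beta> s) = \<beta> s <#\<^bsub>B\<^esub> ?ball \<one>\<^bsub>B\<^esub>"
      by (rule B'.ball_translate)
        (use assms(4) \<beta> that in \<open>auto simp: finite_generating_set_def\<close>)
    moreover have "F \<subseteq> ?ball \<one>\<^bsub>B\<^esub>" using r by (auto simp: graph_ball_def k_def)
    ultimately show ?thesis by (auto simp: l_coset_def)
  qed
  have "\<Lambda>\<^sub>M n \<le> \<Lambda>\<^sub>N (card (?ball \<one>\<^bsub>B\<^esub>) * n)" if "n \<ge> 1" for n
  proof -
    have "connected_subset (carrier A) ?EA {\<one>\<^bsub>A\<^esub>}" by (auto simp: connected_subset_def)
    then obtain S where S: "connected_subset (carrier A) ?EA S" "finite S" "card S = n"
      using GA.connected_superset[OF assms(7), of "{\<one>\<^bsub>A\<^esub>}" n] \<open>n \<ge> 1\<close> by auto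
    have SA: "S \<subseteq> carrier A" using S(1) by (simp add: connected_subset_def)
    have \<beta>S: "\<beta> ` S \<subseteq> carrier B" using \<beta> SA by blast
    have "S \<noteq> {}" using S(3) \<open>n \<ge> 1\<close> by auto
    have "connected_subset (carrier B) ?EB (\<Union>s\<in>S. ?ball (\<beta> s))"
      using GB.connected_Union_balls[OF S(1) \<beta>S] step by blast
    then obtain W where W: "W \<subseteq> carrier B" "(\<Union>s\<in>S. ?ball (\<beta> s)) \<subseteq> W" "finite (N W)"
        "card (N W) = \<Lambda>\<^sub>N (card (?ball \<one>\<^bsub>B\<^esub>) * n)"
      using lamp_group_over_ball_union[OF B.halo_prod_axioms assms(4,8,14) S(2) \<open>S \<noteq> {}\<close>, of \<beta> k] \<beta>S S(3)
      by blast
    have "(\<Union>s\<in>S. \<beta> s <#\<^bsub>B\<^esub> F) \<subseteq> W" using near SA W(2) by blast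
    then have "\<And>c. c \<in> M S \<Longrightarrow> inv\<^bsub>GN\<^esub> (\<alpha> \<one>\<^bsub>GM\<^esub>) \<otimes>\<^bsub>GN\<^esub> \<alpha> c \<in> N W"
      using image S(1) W(1) by simp
    moreover have "M S \<subseteq> carrier GM" by (rule A.L_subset_carrier[OF SA])
    ultimately have "card (M S) \<le> card (N W)"
      using \<alpha> halo_subgroup[OF B.halo_base W(1)] W(3)
      by (intro card_le_of_displacement[OF B.group_lamps, where g = "\<alpha> \<one>\<^bsub>GM\<^esub>" and \<alpha> = \<alpha>])
        (auto intro: inj_on_subset)
    moreover have "card (M S) = \<Lambda>\<^sub>M n"
      using assms(13) S unfolding lamp_growth_sequence_def by blast
    ultimately show ?thesis using W(4) by simp
  qed
  then show ?thesis unfolding dominated_def by blast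
qed

end
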